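(* Let $\Lambda=(\lambda_n)_{n\ge 0}$ be a sequence with $0=\lambda_0<\lambda_n\uparrow+\infty$ ($1\le n\uparrow+\infty$). Let $\Phi\in L$, $h\in L^{+}$ and let $\varphi$ be the inverse function to $\Phi$. If $$(\forall b>0):\quad \sum_{k=0}^{+\infty}\frac{1}{\lambda_{k+1}-\lambda_k}\,h'\Big(\varphi(\lambda_k)+\frac{b}{\lambda_{k+1}-\lambda_k}\Big)<+\infty,$$ then for every $F\in D(\Lambda,\Phi)$ there is a set $E\subset[0,+\infty)$ of finite $h$-measure such that the relation $$F(x+iy)=(1+o(1))\,a_{\nu(x,F)}e^{(x+iy)\lambda_{\nu(x,F)}}$$ holds as $x\to+\infty$, $x\notin E$, uniformly in $y\in\mathbb{R}$.
   Context: $L$ is the class of positive continuous functions on $[0,+\infty)$ increasing to $+\infty$; $L^{+}$ is the subclass of differentiable functions in $L$ with non-decreasing derivative. $D(\Lambda)$ is the class of entire Dirichlet series $F(z)=\sum_{n=0}^{+\infty}a_n e^{z\lambda_n}$ (complex coefficients, absolutely convergent in the whole complex plane). For $F\in D(\Lambda)$ and $x\in\mathbb{R}$: $\mu(x,F)=\max\{|a_n|e^{x\lambda_n}:n\ge0\}$ is the maximal term and $\nu(x,F)=\max\{n:|a_n|e^{x\lambda_n}=\mu(x,F)\}$ is the central index. $D(\Lambda,\Phi)=\{F\in D(\Lambda):\ \text{there is } x_0 \text{ with } \ln\mu(x,F)\ge x\Phi(x)\ \text{for all } x>x_0\}$. The $h$-measure of a measurable set $E\subset[0,+\infty)$ is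 $\int_E dh(x)$. Convention: the finitely many terms of the series for which $\varphi(\lambda_k)$ is not defined (those with $\lambda_k<\Phi(0)$) are disregarded. *)

theory Defs
  imports "HOL-Analysis.Analysis"
begin

text \<open>
  The classes \<open>L\<close> and \<open>L\<^sup>+\<close>. Functions on \<open>[0,\<infinity>)\<close> are represented by functions on \<open>\<real>\<close> whose
  values at negative arguments are irrelevant. As the members of \<open>L\<close> are required to have inverse
  functions, increasing is read as strictly increasing.
\<close>

definition class_L :: "(real \<Rightarrow> real) set" where
  "class_L = {f. (\<forall>x\<ge>0. f x > 0) \<and> continuous_on {0..} f \<and> strict_mono_on {0..} f
                 \<and> filterlim f at_top at_top}"

text \<open>The derivative on \<open>[0,\<infinity>)\<close>, one-sided at \<open>0\<close>.\<close>

definition deriv0 :: "(real \<Rightarrow> real) \<Rightarrow> real \<Rightarrow> real" where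
  "deriv0 f x = vector_derivative f (at x within {0..})"

definition class_L_plus :: "(real \<Rightarrow> real) set" where
  "class_L_plus = {f \<in> class_L. f differentiable_on {0..} \<and> mono_on {0..} (deriv0 f)}"

text \<open>
  A Dirichlet series with exponents \<open>\<lambda>\<^sub>n\<close> is represented by its coefficient sequence \<open>a\<close>; the maximal
  term and the central index are functions of these data.
\<close>

definition dirichlet_sum :: "(nat \<Rightarrow> real) \<Rightarrow> (nat \<Rightarrow> complex) \<Rightarrow> complex \<Rightarrow> complex" where
  "dirichlet_sum lam a z = (\<Sum>n. a n * exp (z * of_real (lam n)))"

definition class_D :: "(nat \<Rightarrow> real) \<Rightarrow> (nat \<Rightarrow> complex) set" where
  "class_D lam = {a. \<forall>z. summable (\<lambda>n. norm (a n * exp (z * of_real (lam n))))}"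

text \<open>
  \<open>GREATEST\<close> is the maximum of a possibly infinite set; \<open>Max\<close> is only meaningful for finite sets.
  The maximum in \<open>max_term\<close> is attained for \<open>a \<in> class_D lam\<close>, since the terms tend to \<open>0\<close>, and the
  one in \<open>central_index\<close> exists as soon as moreover \<open>a\<close> is not identically zero.
\<close>

definition max_term :: "(nat \<Rightarrow> real) \<Rightarrow> (nat \<Rightarrow> complex) \<Rightarrow> real \<Rightarrow> real" where
  "max_term lam a x = (GREATEST t. \<exists>n. t = norm (a n) * exp (x * lam n))"

definition central_index :: "(nat \<Rightarrow> real) \<Rightarrow> (nat \<Rightarrow> complex) \<Rightarrow> real \<Rightarrow> nat" where
  "central_index lam a x = (GREATEST n. norm (a n) * exp (x * lam n) = max_term lam a x)"

definition class_D_Phi :: "(nat \<Rightarrow> real) \<Rightarrow> (real \<Rightarrow> real) \<Rightarrow> (nat \<Rightarrow> complex) set" where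
  "class_D_Phi lam \<Phi> =
     {a \<in> class_D lam. \<exists>x0\<ge>0. \<forall>x>x0. ln (max_term lam a x) \<ge> x * \<Phi> x}"

text \<open>
  The Lebesgue--Stieltjes measure \<open>dh\<close> on \<open>[0,\<infinity>)\<close>: \<open>h\<close> is extended by the constant \<open>h 0\<close> to the
  negative half-line, which therefore carries no mass.
\<close>

definition h_measure :: "(real \<Rightarrow> real) \<Rightarrow> real measure" where
  "h_measure h = interval_measure (\<lambda>x. h (max 0 x))"

end

theory Submission
  imports Defs
begin

text \<open>
  The proof compares the series with its Newton polygon. Write \<open>\<mu>\<close> and \<open>\<nu>\<close> for the maximal term and the
  central index, \<open>\<Delta> k = lam (k + 1) - lam k\<close>, and let \<open>\<kappa> k\<close> be the point at which \<open>\<nu>\<close> passes from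
  values \<open>\<le> k\<close> to values \<open>> k\<close>. The convex function \<open>ln \<mu>\<close> has slope \<open>lam (\<nu> x)\<close> at \<open>x\<close>. Hence the
  numbers \<open>A n = \<mu> (\<kappa> n) * exp (- \<kappa> n * lam n)\<close>, which dominate \<open>norm (a n)\<close>, satisfy the exact
  recursion \<open>A (n + 1) = A n * exp (- \<kappa> n * \<Delta> n)\<close> (\<open>majorant_Suc\<close>). Since \<open>A n * exp (x * lam n)\<close> is at
  most \<open>\<mu> x\<close> for \<open>n = \<nu> x\<close>, telescoping from \<open>\<nu> x\<close> in either direction gives
  \<open>norm (a n) * exp (x * lam n) \<le> \<mu> x * exp (- (\<Sum>j. \<bar>x - \<kappa> j\<bar> * \<Delta> j))\<close>,
  where \<open>j\<close> ranges over the gaps between \<open>lam n\<close> and \<open>lam (\<nu> x)\<close> (\<open>term_decay\<close>).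

  Consequently, if \<open>\<bar>x - \<kappa> j\<bar> * \<Delta> j\<close> is at least \<open>1\<close> for all \<open>j\<close>, and at least \<open>M \<ge> 1\<close> for all \<open>j\<close> from some
  index below \<open>\<nu> x\<close> on, then the terms other than the central one add up to at most
  \<open>4 * exp (- M) * \<mu> x\<close>, whatever the imaginary part is (\<open>remainder_le\<close>). So it suffices to remove, for
  every \<open>m \<ge> 1\<close>, the intervals of radius \<open>m / \<Delta> k\<close> about \<open>\<kappa> k\<close> for all \<open>k\<close> from some index \<open>N m\<close> on, where
  \<open>N m\<close> may be as large as one likes, together with finitely many intervals of radius \<open>1 / \<Delta> k\<close>.

  The \<open>h\<close>-measure of one such interval is at most \<open>2 * m / \<Delta> k * h' (\<kappa> k + m / \<Delta> k)\<close>, because \<open>h'\<close> is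
  non-decreasing. The growth condition on \<open>\<mu>\<close> yields \<open>\<Phi> x \<le> lam (\<nu> x)\<close> for large \<open>x\<close>
  (\<open>central_exponent_ge\<close>). This makes \<open>\<nu>\<close> tend to infinity, and it places the transition points:
  \<open>\<kappa> k \<le> \<phi> (lam k)\<close> for large \<open>k\<close> (\<open>\<kappa>_le_inverse\<close>). Thus the measures of the removed intervals are
  dominated by the terms of the given convergent series with \<open>b = m\<close>, and \<open>N m\<close> can be chosen such
  that the contributions of the various \<open>m\<close> are summable.
\<close>

section \<open>The measure of intervals\<close>

lemma class_L_plus_deriv0:
  assumes "h \<in> class_L_plus" "x > 0"
  shows "(h has_real_derivative deriv0 h x) (at x)"
proof -
  have "(h has_vector_derivative deriv0 h x) (at x within {0..})"
    using assms unfolding class_L_plus_def deriv0_def differentiable_on_def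
    by (intro vector_derivative_works[THEN iffD1]) auto
  moreover have "x \<in> interior {0..}" using assms(2) by simp
  ultimately show ?thesis
    using at_within_interior[of x "{0..}"] has_real_derivative_iff_has_vector_derivative by metis
qed

lemma class_L_plus_deriv0_mono:
  assumes "h \<in> class_L_plus" "0 \<le> s" "s \<le> t"
  shows "deriv0 h s \<le> deriv0 h t"
proof -
  have "mono_on {0..} (deriv0 h)" using assms(1) by (simp add: class_L_plus_def)
  from mono_onD[OF this, of s t] show ?thesis using assms by simp
qed

text \<open>The mean value theorem, the derivative at the intermediate point being at most the one at \<open>t\<close>.\<close>

lemma class_L_plus_increment_le:
  assumes h: "h \<in> class_L_plus" and "0 \<le> s" "s \<le> t"
  shows "h t - h s \<le> (t - s) * deriv0 h t"
proof (cases "s = t")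
  case False
  then have st: "s < t" using assms by simp
  have "continuous_on {s..t} h"
    using h assms(2) unfolding class_L_plus_def class_L_def
    by (auto intro: continuous_on_subset)
  moreover have deriv: "(h has_real_derivative deriv0 h x) (at x)" if "s < x" for x
    using class_L_plus_deriv0[OF h] that assms(2) by simp
  ultimately obtain l z where z: "s < z" "z < t" "(h has_real_derivative l) (at z)"
      and "h t - h s = (t - s) * l"
    using MVT[OF st, of h] real_differentiable_def by blast
  then have eq: "h t - h s = (t - s) * deriv0 h z"
    using DERIV_unique[OF z(3) deriv[OF z(1)]] by simp
  have "deriv0 h z \<le> deriv0 h t"
    using class_L_plus_deriv0_mono[OF h] z assms by simp
  then show ?thesis using st by (simp add: eq)
qed simp

lemma deriv0_nonneg:
  assumes h: "h \<in> class_L_plus" and "0 < x"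
  shows "0 \<le> deriv0 h x"
proof -
  have "strict_mono_on {0..} h" using h by (simp add: class_L_plus_def class_L_def)
  from strict_mono_onD[OF this, of 0 x] have "h 0 < h x" using assms(2) by simp
  moreover have "h x - h 0 \<le> (x - 0) * deriv0 h x"
    using class_L_plus_increment_le[OF h, of 0 x] assms(2) by simp
  ultimately have "0 < x * deriv0 h x" by simp
  then show ?thesis using assms(2) by (simp add: zero_less_mult_iff)
qed

text \<open>
  The left end point may be negative; as the negative half-line carries no mass, the bound for the
  increment of \<open>h\<close> is applied on the part of the interval in \<open>[0,\<infinity>)\<close>. The centre is allowed to be smaller
  than the point \<open>d\<close> in the bound, since the transition points are only known to be at most
  \<open>\<phi> (lam k)\<close>.
\<close>

lemma h_measure_interval_le:
  assumes h: "h \<in> class_L_plus" and "0 \<le> c" "c \<le> d" "0 < r"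
  shows "emeasure (h_measure h) {c - r<..<c + r} \<le> ennreal (2 * r * deriv0 h (d + r))"
proof -
  let ?H = "\<lambda>x. h (max 0 x)"
  have L: "h \<in> class_L" using h by (simp add: class_L_plus_def)
  have cont: "continuous_on {0..} h" and sm: "strict_mono_on {0..} h"
    using L by (auto simp: class_L_def)
  have monoh: "h s \<le> h t" if "0 \<le> s" "s \<le> t" for s t
    using strict_mono_on_leD[OF sm, of s t] that by auto
  have mono: "?H s \<le> ?H t" if "s \<le> t" for s t
    using that by (intro monoh) auto
  have contH: "continuous_on UNIV ?H"
    by (rule continuous_on_compose2[OF cont]) (intro continuous_intros, auto)
  have "emeasure (h_measure h) {c - r<..<c + r} \<le> emeasure (h_measure h) {c - r<..c + r}"
    by (rule emeasure_mono) (auto simp: h_measure_def)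
  also have "\<dots> = ennreal (?H (c + r) - ?H (c - r))"
    unfolding h_measure_def
  proof (rule emeasure_interval_measure_Ioc)
    show "continuous (at_right x) ?H" for x
      using contH by (simp add: continuous_on_eq_continuous_at continuous_at_imp_continuous_at_within)
    show "c - r \<le> c + r" using assms(4) by simp
  qed (rule mono)
  also have "\<dots> \<le> ennreal (2 * r * deriv0 h (d + r))"
  proof (rule ennreal_leI)
    have "max 0 (c + r) = c + r" using assms by simp
    moreover have "h (c + r) - h (max 0 (c - r)) \<le> (c + r - max 0 (c - r)) * deriv0 h (c + r)"
      by (rule class_L_plus_increment_le[OF h]) (use assms(2-4) in auto)
    ultimately have "?H (c + r) - ?H (c - r) \<le> (c + r - max 0 (c - r)) * deriv0 h (c + r)"
      by simp
    also have "\<dots> \<le> 2 * r * deriv0 h (d + r)"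
    proof (rule mult_mono)
      show "deriv0 h (c + r) \<le> deriv0 h (d + r)"
        by (rule class_L_plus_deriv0_mono[OF h]) (use assms(2-4) in auto)
      show "0 \<le> deriv0 h (c + r)" by (rule deriv0_nonneg[OF h]) (use assms(2-4) in auto)
    qed (use assms(2-4) in auto)
    finally show "?H (c + r) - ?H (c - r) \<le> 2 * r * deriv0 h (d + r)" .
  qed
  finally show ?thesis .
qed

text \<open>
  Countable subadditivity bounds the measure of the union by twice a tail of the given series.
\<close>

lemma h_measure_interval_tail_le:
  fixes c d r :: "nat \<Rightarrow> real"
  assumes h: "h \<in> class_L_plus" and K: "\<And>k. k \<ge> K \<Longrightarrow> 0 \<le> c k \<and> c k \<le> d k"
    and r: "\<And>k. 0 < r k"
    and sum: "(\<lambda>k. r k * deriv0 h (d k + r k)) summable_on {K..}"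
    and "0 < \<epsilon>"
  shows "\<exists>N\<ge>K. emeasure (h_measure h) (\<Union>k\<in>{N..}. {c k - r k<..<c k + r k}) \<le> ennreal \<epsilon>"
proof -
  define f where "f i = 2 * r (i + K) * deriv0 h (d (i + K) + r (i + K))" for i
  have f0: "0 \<le> f i" for i
    using deriv0_nonneg[OF h, of "d (i + K) + r (i + K)"] K[of "i + K"] r[of "i + K"]
    by (simp add: f_def)
  have bij: "bij_betw (\<lambda>i. i + K) UNIV {K..}"
    by (rule bij_betwI[where g = "\<lambda>i. i - K"]) auto
  have "(\<lambda>i. r (i + K) * deriv0 h (d (i + K) + r (i + K))) summable_on UNIV"
    using sum by (subst summable_on_reindex_bij_betw[OF bij])
  then have "f summable_on UNIV"
    unfolding f_def mult.assoc by (rule summable_on_cmult_right)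
  then have "summable f" by (subst (asm) summable_on_UNIV_nonneg_real_iff[OF f0])
  from suminf_exist_split[OF \<open>0 < \<epsilon>\<close> this]
  obtain M where M: "norm (\<Sum>i. f (i + M)) < \<epsilon>" by blast
  have sf: "summable (\<lambda>i. f (i + M))" using \<open>summable f\<close> by (simp add: summable_iff_shift)
  let ?U = "\<lambda>k. {c k - r k<..<c k + r k}"
  have img: "{M + K..} = range (\<lambda>i. i + M + K)"
  proof (intro equalityI subsetI)
    fix k assume "k \<in> {M + K..}"
    then have "k = (k - (M + K)) + M + K" by simp
    then show "k \<in> range (\<lambda>i. i + M + K)" by (rule range_eqI)
  qed auto
  have "emeasure (h_measure h) (\<Union>k\<in>{M + K..}. ?U k)
          = emeasure (h_measure h) (\<Union>i. ?U (i + M + K))"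
    unfolding img by (simp add: image_image)
  also have "\<dots> \<le> (\<Sum>i. emeasure (h_measure h) (?U (i + M + K)))"
    by (rule emeasure_subadditive_countably) (auto simp: h_measure_def)
  also have "\<dots> \<le> (\<Sum>i. ennreal (f (i + M)))"
  proof (rule suminf_le)
    show "emeasure (h_measure h) (?U (i + M + K)) \<le> ennreal (f (i + M))" for i
      unfolding f_def
      by (rule h_measure_interval_le[OF h]) (use K[of "i + M + K"] r in auto)
  qed auto
  also have "\<dots> = ennreal (\<Sum>i. f (i + M))"
    using f0 sf by (intro suminf_ennreal2) auto
  also have "\<dots> \<le> ennreal \<epsilon>" using M by (intro ennreal_leI) auto
  finally show ?thesis by (intro exI[of _ "M + K"]) auto
qed

section \<open>Maximal term and central index\<close>

locale nonzero_dirichlet =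
  fixes lam :: "nat \<Rightarrow> real" and a :: "nat \<Rightarrow> complex"
  assumes lam_mono: "strict_mono lam"
    and class_D: "a \<in> class_D lam"
    and nonzero: "\<exists>n. a n \<noteq> 0"
begin

abbreviation \<mu> where "\<mu> \<equiv> max_term lam a"
abbreviation \<nu> where "\<nu> \<equiv> central_index lam a"

lemma norm_term: "norm (a n * exp (Complex x y * of_real (lam n))) = norm (a n) * exp (x * lam n)"
  by (simp add: norm_mult norm_exp_eq_Re)

lemma summable_norm_term: "summable (\<lambda>n. norm (a n) * exp (x * lam n))"
proof -
  have "summable (\<lambda>n. norm (a n * exp (Complex x 0 * of_real (lam n))))"
    using class_D by (auto simp: class_D_def)
  then show ?thesis by (simp only: norm_term)
qed

text \<open>
  The terms tend to \<open>0\<close>, so only finitely many of them reach a given positive level. Hence both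
  maxima in the definitions of \<open>max_term\<close> and \<open>central_index\<close> are attained; the strict
  inequality beyond \<open>\<nu> x\<close> expresses that \<open>\<nu> x\<close> is the last index of a maximal term.
\<close>

lemma central_index_props:
  shows norm_central: "norm (a (\<nu> x)) * exp (x * lam (\<nu> x)) = \<mu> x"
    and term_le_max: "norm (a n) * exp (x * lam n) \<le> \<mu> x"
    and max_term_pos: "0 < \<mu> x"
    and term_less_max: "\<nu> x < n \<Longrightarrow> norm (a n) * exp (x * lam n) < \<mu> x"
proof -
  let ?t = "\<lambda>n. norm (a n) * exp (x * lam n)"
  have fin: "finite {n. e \<le> ?t n}" if "0 < e" for e
  proof -
    have "?t \<longlonglongrightarrow> 0" by (rule summable_LIMSEQ_zero[OF summable_norm_term])
    then have "\<forall>\<^sub>F n in sequentially. ?t n < e" using that by (rule order_tendstoD)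
    then obtain N where "\<And>n. n \<ge> N \<Longrightarrow> ?t n < e" by (auto simp: eventually_sequentially)
    then have "{n. e \<le> ?t n} \<subseteq> {..<N}" by (force simp: not_le[symmetric])
    then show ?thesis by (rule finite_subset) simp
  qed
  obtain n0 where n0: "a n0 \<noteq> 0" using nonzero by blast
  then have t0: "0 < ?t n0" by simp
  let ?S = "{n. ?t n0 \<le> ?t n}"
  have S: "finite (?t ` ?S)" "?t ` ?S \<noteq> {}" using fin[OF t0] by auto
  obtain p where p: "p \<in> ?S" "?t p = Max (?t ` ?S)" using Max_in[OF S] by auto
  have le_p: "?t n \<le> ?t p" for n
  proof (cases "n \<in> ?S")
    case True then show ?thesis unfolding p(2) by (intro Max_ge S imageI)
  next
    case False then show ?thesis using p(1) by auto
  qed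
  have mu: "\<mu> x = ?t p"
    unfolding max_term_def by (rule Greatest_equality) (use le_p in auto)
  show le: "?t n \<le> \<mu> x" for n using le_p by (simp add: mu)
  show pos: "0 < \<mu> x" using t0 le[of n0] by linarith
  have "finite {n. ?t n = \<mu> x}"
    by (rule finite_subset[OF _ fin[OF pos]]) auto
  then obtain B where B: "\<And>n. ?t n = \<mu> x \<Longrightarrow> n \<le> B"
    by (metis (mono_tags, lifting) finite_nat_set_iff_bounded_le mem_Collect_eq)
  show "?t (\<nu> x) = \<mu> x"
    unfolding central_index_def by (rule GreatestI_nat[where k = p and b = B]) (use mu B in auto)
  show "?t n < \<mu> x" if "\<nu> x < n"
  proof (rule ccontr)
    assume "\<not> ?t n < \<mu> x"
    then have "?t n = \<mu> x" using le[of n] by simp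
    then have "n \<le> \<nu> x"
      unfolding central_index_def by (rule Greatest_le_nat) (use B in auto)
    with that show False by simp
  qed
qed

text \<open>
  The function \<open>ln \<mu>\<close> is a maximum of affine functions, one of which, of slope \<open>lam (\<nu> x)\<close>, touches it
  at \<open>x\<close>. The inequality holds on both sides of \<open>x\<close>, and all further information about \<open>\<mu>\<close> is
  drawn from it.
\<close>

lemma max_term_supporting_line: "\<mu> x * exp ((y - x) * lam (\<nu> x)) \<le> \<mu> y"
proof -
  have "\<mu> x * exp ((y - x) * lam (\<nu> x)) = norm (a (\<nu> x)) * exp (y * lam (\<nu> x))"
    unfolding norm_central[of x, symmetric] by (simp add: mult.assoc flip: exp_add) (simp add: algebra_simps)
  then show ?thesis using term_le_max by simp
qed

lemma central_index_mono: assumes "x \<le> y" shows "\<nu> x \<le> \<nu> y"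
proof (rule ccontr)
  assume "\<not> \<nu> x \<le> \<nu> y"
  then have less: "\<nu> y < \<nu> x" by simp
  then have ll: "lam (\<nu> y) < lam (\<nu> x)" using lam_mono by (simp add: strict_mono_less)
  have "\<mu> x * exp ((y - x) * lam (\<nu> x)) = norm (a (\<nu> x)) * exp (y * lam (\<nu> x))"
    unfolding norm_central[of x, symmetric] by (simp add: mult.assoc flip: exp_add) (simp add: algebra_simps)
  also have "\<dots> < \<mu> y" by (rule term_less_max[OF less])
  also have "\<mu> y = \<mu> y * exp ((x - y) * lam (\<nu> y)) * exp ((y - x) * lam (\<nu> y))"
    by (simp add: mult.assoc flip: exp_add) (simp add: algebra_simps)
  also have "\<dots> \<le> \<mu> x * exp ((y - x) * lam (\<nu> y))"
    using max_term_supporting_line[of y x] by simp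
  also have "\<dots> \<le> \<mu> x * exp ((y - x) * lam (\<nu> x))"
    using ll assms max_term_pos[of x] by (simp add: mult_left_mono)
  finally show False by simp
qed

text \<open>
  The supporting line at \<open>x\<close>, evaluated at a fixed point \<open>x1 \<ge> 1\<close>, gives
  \<open>x \<Phi> x \<le> ln (\<mu> x) \<le> ln (\<mu> x1) + (x - x1) lam (\<nu> x)\<close>. If \<open>lam (\<nu> x)\<close> were smaller than \<open>\<Phi> x\<close>,
  then \<open>x1 \<Phi> x\<close> would be at most the constant \<open>ln (\<mu> x1)\<close>, which fails for large \<open>x\<close>.
\<close>

lemma central_exponent_ge:
  assumes \<Phi>: "\<Phi> \<in> class_L" and a: "a \<in> class_D_Phi lam \<Phi>"
  shows "\<exists>X\<ge>0. \<forall>x\<ge>X. \<Phi> x \<le> lam (\<nu> x)"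
proof -
  obtain x0 where x0: "0 \<le> x0" "\<And>x. x0 < x \<Longrightarrow> x * \<Phi> x \<le> ln (\<mu> x)"
    using a by (auto simp: class_D_Phi_def)
  define x1 where "x1 = x0 + 1"
  have lim: "filterlim \<Phi> at_top at_top" and pos: "\<And>x. 0 \<le> x \<Longrightarrow> 0 < \<Phi> x"
    using \<Phi> by (auto simp: class_L_def)
  have "\<forall>\<^sub>F x in at_top. ln (\<mu> x1) < \<Phi> x"
    using lim by (simp add: filterlim_at_top_dense)
  then obtain B where B: "\<And>x. B \<le> x \<Longrightarrow> ln (\<mu> x1) < \<Phi> x"
    by (auto simp: eventually_at_top_linorder)
  have "\<Phi> x \<le> lam (\<nu> x)" if "max x1 B \<le> x" for x
  proof (rule ccontr)
    assume less: "\<not> \<Phi> x \<le> lam (\<nu> x)"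
    have x: "x1 \<le> x" "0 \<le> x1" "1 \<le> x1" "x0 < x" using that x0 by (auto simp: x1_def)
    have "ln (\<mu> x * exp ((x1 - x) * lam (\<nu> x))) \<le> ln (\<mu> x1)"
      using max_term_supporting_line[of x x1] max_term_pos by (subst ln_le_cancel_iff) auto
    then have "ln (\<mu> x) - (x - x1) * lam (\<nu> x) \<le> ln (\<mu> x1)"
      using max_term_pos[of x] by (simp add: ln_mult_pos algebra_simps)
    moreover have "x * \<Phi> x \<le> ln (\<mu> x)" using x0 x by simp
    moreover have "(x - x1) * lam (\<nu> x) \<le> (x - x1) * \<Phi> x"
      using less x by (intro mult_left_mono) auto
    moreover have "1 * \<Phi> x \<le> x1 * \<Phi> x"
      using x pos[of x] by (intro mult_right_mono) auto
    moreover have "ln (\<mu> x1) < \<Phi> x" using that by (intro B) simp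
    ultimately show False by (simp add: algebra_simps)
  qed
  moreover have "0 \<le> max x1 B" using x0 by (simp add: x1_def)
  ultimately show ?thesis by blast
qed

end

section \<open>Transition points of the central index\<close>

locale unbounded_dirichlet = nonzero_dirichlet +
  assumes central_index_unbounded: "\<And>n. \<exists>x\<ge>0. n < central_index lam a x"
begin

text \<open>
  The infimum is taken over \<open>x \<ge> 0\<close> only: if the coefficients up to \<open>n\<close> vanish, then \<open>n < \<nu> x\<close> for all real
  \<open>x\<close>, and the unrestricted infimum would not exist. The truncation at \<open>0\<close> is harmless, because
  the asymptotic relation only concerns large \<open>x\<close>.
\<close>

definition \<kappa> :: "nat \<Rightarrow> real" where "\<kappa> n = Inf {x. 0 \<le> x \<and> n < \<nu> x}"

lemma \<kappa>_set: "{x. 0 \<le> x \<and> n < \<nu> x} \<noteq> {}" "bdd_below {x. 0 \<le> x \<and> n < \<nu> x}"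
  using central_index_unbounded[of n] by (auto intro: bdd_belowI[of _ 0])

lemma \<kappa>_nonneg: "0 \<le> \<kappa> n"
  unfolding \<kappa>_def by (rule cInf_greatest[OF \<kappa>_set(1)]) auto

lemma \<kappa>_le: "0 \<le> x \<Longrightarrow> n < \<nu> x \<Longrightarrow> \<kappa> n \<le> x"
  unfolding \<kappa>_def by (rule cInf_lower[OF _ \<kappa>_set(2)]) auto

lemma \<kappa>_ge: assumes "\<nu> x \<le> n" shows "x \<le> \<kappa> n"
  unfolding \<kappa>_def
proof (rule cInf_greatest[OF \<kappa>_set(1)])
  fix y assume "y \<in> {x. 0 \<le> x \<and> n < \<nu> x}"
  then have "\<not> \<nu> y \<le> \<nu> x" using assms by auto
  then show "x \<le> y" using central_index_mono[of y x] by linarith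
qed

lemma central_index_le_before_\<kappa>: "0 \<le> x \<Longrightarrow> x < \<kappa> n \<Longrightarrow> \<nu> x \<le> n"
  using \<kappa>_le[of x n] by linarith

lemma central_index_gr_after_\<kappa>: "\<kappa> n < x \<Longrightarrow> n < \<nu> x"
  using \<kappa>_ge[of x n] by linarith

lemma \<kappa>_mono: "\<kappa> n \<le> \<kappa> (Suc n)"
  unfolding \<kappa>_def by (rule cInf_superset_mono[OF \<kappa>_set(1) \<kappa>_set(2)]) auto

text \<open>
  Up to \<open>\<kappa> n\<close> the slope of \<open>ln \<mu>\<close> is at most \<open>lam n\<close>, after \<open>\<kappa> n\<close> it is at least \<open>lam (n + 1)\<close>. The supporting
  lines show this for points different from \<open>\<kappa> n\<close>; the value at \<open>\<kappa> n\<close> itself is reached by a limit,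
  for which the continuity of the single term that is maximal at \<open>\<kappa> n\<close> is enough.
\<close>

lemma max_term_growth_before_\<kappa>:
  assumes "0 \<le> x" "x \<le> \<kappa> n"
  shows "\<mu> (\<kappa> n) \<le> \<mu> x * exp ((\<kappa> n - x) * lam n)"
proof (cases "x = \<kappa> n")
  case False
  let ?N = "\<nu> (\<kappa> n)"
  have "norm (a ?N) * exp (\<kappa> n * lam ?N) \<le> \<mu> x * exp ((\<kappa> n - x) * lam n)"
  proof (rule tendsto_le[where F = "at_left (\<kappa> n)"])
    show "((\<lambda>y. norm (a ?N) * exp (y * lam ?N)) \<longlongrightarrow> norm (a ?N) * exp (\<kappa> n * lam ?N)) (at_left (\<kappa> n))"
      by (intro tendsto_intros)
    show "((\<lambda>y. \<mu> x * exp ((y - x) * lam n)) \<longlongrightarrow> \<mu> x * exp ((\<kappa> n - x) * lam n)) (at_left (\<kappa> n))"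
      by (intro tendsto_intros)
    have "norm (a ?N) * exp (y * lam ?N) \<le> \<mu> x * exp ((y - x) * lam n)"
      if "y \<in> {x<..<\<kappa> n}" for y
    proof -
      have "\<nu> y \<le> n" using central_index_le_before_\<kappa> that assms by simp
      then have "lam (\<nu> y) \<le> lam n" using lam_mono by (simp add: strict_mono_less_eq)
      have "norm (a ?N) * exp (y * lam ?N) \<le> \<mu> y" by (rule term_le_max)
      also have "\<mu> y = \<mu> y * exp ((x - y) * lam (\<nu> y)) * exp ((y - x) * lam (\<nu> y))"
        by (simp add: mult.assoc flip: exp_add) (simp add: algebra_simps)
      also have "\<dots> \<le> \<mu> x * exp ((y - x) * lam (\<nu> y))"
        using max_term_supporting_line[of y x] by simp
      also have "\<dots> \<le> \<mu> x * exp ((y - x) * lam n)"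
        using \<open>lam (\<nu> y) \<le> lam n\<close> that max_term_pos[of x] by (simp add: mult_left_mono)
      finally show ?thesis .
    qed
    moreover have "x < \<kappa> n" using False assms by simp
    ultimately show "\<forall>\<^sub>F y in at_left (\<kappa> n). norm (a ?N) * exp (y * lam ?N) \<le> \<mu> x * exp ((y - x) * lam n)"
      by (intro eventually_mono[OF eventually_at_left_real])
  qed simp
  then show ?thesis by (simp add: norm_central)
qed simp

lemma max_term_growth_after_\<kappa>:
  assumes "\<kappa> n \<le> x"
  shows "\<mu> (\<kappa> n) * exp ((x - \<kappa> n) * lam (Suc n)) \<le> \<mu> x"
proof (cases "x = \<kappa> n")
  case False
  let ?N = "\<nu> (\<kappa> n)"
  have "norm (a ?N) * exp (\<kappa> n * lam ?N) * exp ((x - \<kappa> n) * lam (Suc n)) \<le> \<mu> x"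
  proof (rule tendsto_upperbound[where F = "at_right (\<kappa> n)"])
    show "((\<lambda>y. norm (a ?N) * exp (y * lam ?N) * exp ((x - y) * lam (Suc n)))
      \<longlongrightarrow> norm (a ?N) * exp (\<kappa> n * lam ?N) * exp ((x - \<kappa> n) * lam (Suc n))) (at_right (\<kappa> n))"
      by (intro tendsto_intros)
    have "norm (a ?N) * exp (y * lam ?N) * exp ((x - y) * lam (Suc n)) \<le> \<mu> x"
      if "y \<in> {\<kappa> n<..<x}" for y
    proof -
      have "Suc n \<le> \<nu> y" using central_index_gr_after_\<kappa> that by (simp add: Suc_le_eq)
      then have "lam (Suc n) \<le> lam (\<nu> y)" using lam_mono by (simp add: strict_mono_less_eq)
      then have "norm (a ?N) * exp (y * lam ?N) * exp ((x - y) * lam (Suc n))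
                   \<le> \<mu> y * exp ((x - y) * lam (\<nu> y))"
        using that by (intro mult_mono term_le_max) (auto intro: order.strict_implies_order[OF max_term_pos] mult_left_mono)
      also have "\<dots> \<le> \<mu> x" by (rule max_term_supporting_line)
      finally show ?thesis .
    qed
    moreover have "\<kappa> n < x" using False assms by simp
    ultimately show "\<forall>\<^sub>F y in at_right (\<kappa> n). norm (a ?N) * exp (y * lam ?N) * exp ((x - y) * lam (Suc n)) \<le> \<mu> x"
      by (intro eventually_mono[OF eventually_at_right_real])
  qed simp
  then show ?thesis by (simp add: norm_central)
qed simp

section \<open>Decay of the terms away from the central index\<close>

text \<open>
  The regularised coefficients: \<open>- ln (majorant n)\<close> is the ordinate at \<open>lam n\<close> of the Newton polygon of
  the points \<open>(lam k, - ln (norm (a k)))\<close>, with its part of negative slope replaced by a horizontal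
  line, and \<open>\<kappa> n\<close> is the slope of the resulting polygon between \<open>lam n\<close> and \<open>lam (n + 1)\<close>.
\<close>

definition majorant :: "nat \<Rightarrow> real" where
  "majorant n = \<mu> (\<kappa> n) * exp (- \<kappa> n * lam n)"

lemma norm_le_majorant: "norm (a n) \<le> majorant n"
proof -
  have "norm (a n) = norm (a n) * exp (\<kappa> n * lam n) * exp (- \<kappa> n * lam n)"
    by (simp add: mult.assoc flip: exp_add)
  also have "\<dots> \<le> majorant n"
    unfolding majorant_def using term_le_max by (intro mult_right_mono) auto
  finally show ?thesis .
qed

text \<open>
  Between \<open>\<kappa> n\<close> and \<open>\<kappa> (n + 1)\<close> the slope of \<open>ln \<mu>\<close> is squeezed to the single value \<open>lam (n + 1)\<close>.
\<close>

lemma majorant_Suc: "majorant (Suc n) = majorant n * exp (- \<kappa> n * (lam (Suc n) - lam n))"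
proof -
  have "majorant n * exp (- \<kappa> n * (lam (Suc n) - lam n)) = \<mu> (\<kappa> n) * exp (- \<kappa> n * lam (Suc n))"
    by (simp add: majorant_def mult.assoc flip: exp_add) (simp add: algebra_simps)
  moreover have "majorant (Suc n) \<le> \<mu> (\<kappa> n) * exp (- \<kappa> n * lam (Suc n))"
  proof -
    have "majorant (Suc n) \<le> \<mu> (\<kappa> n) * exp ((\<kappa> (Suc n) - \<kappa> n) * lam (Suc n)) * exp (- \<kappa> (Suc n) * lam (Suc n))"
      unfolding majorant_def
      by (intro mult_right_mono max_term_growth_before_\<kappa> \<kappa>_nonneg \<kappa>_mono) simp
    then show ?thesis by (simp add: mult.assoc flip: exp_add) (simp add: algebra_simps)
  qed
  moreover have "\<mu> (\<kappa> n) * exp (- \<kappa> n * lam (Suc n)) \<le> majorant (Suc n)"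
  proof -
    have "\<mu> (\<kappa> n) * exp ((\<kappa> (Suc n) - \<kappa> n) * lam (Suc n)) * exp (- \<kappa> (Suc n) * lam (Suc n)) \<le> majorant (Suc n)"
      unfolding majorant_def
      by (intro mult_right_mono max_term_growth_after_\<kappa> \<kappa>_mono) simp
    then show ?thesis by (simp add: mult.assoc flip: exp_add) (simp add: algebra_simps)
  qed
  ultimately show ?thesis by simp
qed

lemma majorant_central_le:
  assumes "0 \<le> x" shows "majorant (\<nu> x) * exp (x * lam (\<nu> x)) \<le> \<mu> x"
proof -
  have "majorant (\<nu> x) * exp (x * lam (\<nu> x))
     \<le> \<mu> x * exp ((\<kappa> (\<nu> x) - x) * lam (\<nu> x)) * exp (- \<kappa> (\<nu> x) * lam (\<nu> x)) * exp (x * lam (\<nu> x))"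
    unfolding majorant_def
    by (intro mult_right_mono max_term_growth_before_\<kappa> assms \<kappa>_ge) auto
  also have "\<dots> = \<mu> x" by (simp add: mult.assoc flip: exp_add) (simp add: algebra_simps)
  finally show ?thesis .
qed

text \<open>
  Passing from \<open>n\<close> to \<open>n + 1\<close> multiplies \<open>majorant n * exp (x * lam n)\<close> by the exponential of
  \<open>(x - \<kappa> n) * (lam (n + 1) - lam n)\<close>. This exponent is non-positive for \<open>n \<ge> \<nu> x\<close> and non-negative for
  \<open>n < \<nu> x\<close>, so each step away from \<open>\<nu> x\<close>, upwards or downwards, costs a factor of at most \<open>exp (- s n)\<close>.
\<close>

lemma term_decay:
  assumes x: "0 \<le> x" and s: "\<And>j. s j \<le> \<bar>x - \<kappa> j\<bar> * (lam (Suc j) - lam j)"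
  shows term_decay_above: "norm (a (\<nu> x + i)) * exp (x * lam (\<nu> x + i)) \<le> \<mu> x * exp (- (\<Sum>j<i. s (\<nu> x + j)))"
    and term_decay_below: "i \<le> \<nu> x \<Longrightarrow> norm (a (\<nu> x - i)) * exp (x * lam (\<nu> x - i)) \<le> \<mu> x * exp (- (\<Sum>j<i. s (\<nu> x - Suc j)))"
proof -
  define T where "T n = majorant n * exp (x * lam n)" for n
  have le: "norm (a n) * exp (x * lam n) \<le> T n" for n
    unfolding T_def using norm_le_majorant by simp
  have T0: "0 \<le> T n" for n unfolding T_def majorant_def using max_term_pos[of "\<kappa> n"] by simp
  have step: "T (Suc n) = T n * exp ((x - \<kappa> n) * (lam (Suc n) - lam n))" for n
    unfolding T_def majorant_Suc by (simp add: mult.assoc flip: exp_add) (simp add: algebra_simps)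
  have "T (\<nu> x + i) \<le> \<mu> x * exp (- (\<Sum>j<i. s (\<nu> x + j)))"
  proof (induction i)
    case 0 show ?case using majorant_central_le[OF x] by (simp add: T_def)
  next
    case (Suc i)
    have "x \<le> \<kappa> (\<nu> x + i)" by (rule \<kappa>_ge) simp
    then have "(x - \<kappa> (\<nu> x + i)) * (lam (Suc (\<nu> x + i)) - lam (\<nu> x + i)) \<le> - s (\<nu> x + i)"
      using s[of "\<nu> x + i"] by (simp add: abs_if algebra_simps split: if_splits)
    then have "T (\<nu> x + Suc i) \<le> T (\<nu> x + i) * exp (- s (\<nu> x + i))"
      using step[of "\<nu> x + i"] T0 by (simp add: mult_left_mono)
    also have "\<dots> \<le> \<mu> x * exp (- (\<Sum>j<i. s (\<nu> x + j))) * exp (- s (\<nu> x + i))"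
      by (intro mult_right_mono Suc) simp
    finally show ?case by (simp add: mult.assoc flip: exp_add)
  qed
  then show "norm (a (\<nu> x + i)) * exp (x * lam (\<nu> x + i)) \<le> \<mu> x * exp (- (\<Sum>j<i. s (\<nu> x + j)))"
    using le[of "\<nu> x + i"] by linarith
  have "T (\<nu> x - i) \<le> \<mu> x * exp (- (\<Sum>j<i. s (\<nu> x - Suc j)))" if "i \<le> \<nu> x"
    using that
  proof (induction i)
    case 0 show ?case using majorant_central_le[OF x] by (simp add: T_def)
  next
    case (Suc i)
    define p where "p = \<nu> x - Suc i"
    have p: "Suc p = \<nu> x - i" using Suc.prems by (simp add: p_def)
    have "\<kappa> p \<le> x" by (rule \<kappa>_le[OF x]) (use p in simp)
    then have *: "- ((x - \<kappa> p) * (lam (Suc p) - lam p)) \<le> - s p"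
      using s[of p] by simp
    have "T p = T (Suc p) * exp (- ((x - \<kappa> p) * (lam (Suc p) - lam p)))"
      unfolding step by (simp add: mult.assoc flip: exp_add)
    also have "\<dots> \<le> T (Suc p) * exp (- s p)"
      using * T0 by (simp add: mult_left_mono)
    also have "\<dots> \<le> \<mu> x * exp (- (\<Sum>j<i. s (\<nu> x - Suc j))) * exp (- s p)"
      unfolding p using Suc by (intro mult_right_mono) auto
    finally show ?case by (simp add: mult.assoc p_def flip: exp_add)
  qed
  then show "norm (a (\<nu> x - i)) * exp (x * lam (\<nu> x - i)) \<le> \<mu> x * exp (- (\<Sum>j<i. s (\<nu> x - Suc j)))"
    if "i \<le> \<nu> x" using le[of "\<nu> x - i"] that by fastforce
qed

text \<open>
  Both gaps adjacent to \<open>lam (\<nu> x)\<close> have an index \<open>\<ge> N\<close>, since \<open>N < \<nu> x\<close>. Every term other than the central one is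
  separated from it by one of these, which yields the factor \<open>exp (- M)\<close>; each further gap
  contributes at least a factor \<open>exp (- 1) \<le> 1 / 2\<close>. The constant \<open>4\<close> is the sum of two geometric series,
  one for either side.
\<close>

lemma remainder_le:
  assumes x: "0 \<le> x"
    and sep: "\<And>j. 1 \<le> \<bar>x - \<kappa> j\<bar> * (lam (Suc j) - lam j)"
    and sep_M: "\<And>j. N \<le> j \<Longrightarrow> M \<le> \<bar>x - \<kappa> j\<bar> * (lam (Suc j) - lam j)"
    and "1 \<le> M" "N < \<nu> x"
  shows "norm (dirichlet_sum lam a (Complex x y)
           - a (\<nu> x) * exp (Complex x y * of_real (lam (\<nu> x)))) \<le> 4 * exp (- M) * \<mu> x"
proof -
  define s where "s j = (if N \<le> j then M else 1)" for j
  define u where "u n = a n * exp (Complex x y * of_real (lam n))" for n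
  define C where "C = \<mu> x * exp (- M)"
  have norm_u: "norm (u n) = norm (a n) * exp (x * lam n)" for n
    unfolding u_def by (rule norm_term)
  have s: "s j \<le> \<bar>x - \<kappa> j\<bar> * (lam (Suc j) - lam j)" for j
    using sep[of j] sep_M[of j] by (simp add: s_def)
  have s1: "1 \<le> s j" for j using assms(4) by (simp add: s_def)
  have C: "0 \<le> C" unfolding C_def using max_term_pos[of x] by simp
  have geometric: "\<mu> x * exp (- (\<Sum>j<Suc i. g j)) \<le> C * (1/2) ^ i"
    if "g 0 = M" "\<And>j. 1 \<le> g j" for g i
  proof -
    have "(\<Sum>j<Suc i. g j) = M + (\<Sum>j<i. g (Suc j))"
      by (subst sum.lessThan_Suc_shift) (simp add: that)
    moreover have "real i \<le> (\<Sum>j<i. g (Suc j))"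
      using sum_mono[of "{..<i}" "\<lambda>_. 1::real" "\<lambda>j. g (Suc j)"] that by simp
    ultimately have "\<mu> x * exp (- (\<Sum>j<Suc i. g j)) \<le> \<mu> x * exp (- M - real i)"
      using max_term_pos[of x] by simp
    also have "\<dots> = C * exp (- 1) ^ i"
      by (simp add: C_def exp_diff exp_minus field_simps flip: exp_of_nat_mult)
    also have "exp (- 1) \<le> (1/2 :: real)"
      using exp_ge_add_one_self[of 1] by (simp add: exp_minus field_simps)
    then have "C * exp (- 1) ^ i \<le> C * (1/2) ^ i"
      using C by (intro mult_left_mono power_mono) auto
    finally show ?thesis .
  qed
  have above: "norm (u (i + Suc (\<nu> x))) \<le> C * (1/2) ^ i" for i
  proof -
    have "norm (u (\<nu> x + Suc i)) \<le> \<mu> x * exp (- (\<Sum>j<Suc i. s (\<nu> x + j)))"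
      unfolding norm_u by (rule term_decay_above[OF x s])
    also have "\<dots> \<le> C * (1/2) ^ i"
      using assms(5) by (intro geometric s1) (simp add: s_def)
    finally show ?thesis by (simp add: add.commute)
  qed
  have below: "norm (u (\<nu> x - Suc i)) \<le> C * (1/2) ^ i" if "i < \<nu> x" for i
  proof -
    have "norm (u (\<nu> x - Suc i)) \<le> \<mu> x * exp (- (\<Sum>j<Suc i. s (\<nu> x - Suc j)))"
      unfolding norm_u using that by (intro term_decay_below[OF x s]) auto
    also have "\<dots> \<le> C * (1/2) ^ i"
      using assms(5) by (intro geometric s1) (simp add: s_def)
    finally show ?thesis .
  qed
  have geo: "(\<lambda>i. C * (1/2) ^ i) sums (C * 2)"
    using geometric_sums[of "1/2::real"] by (intro sums_mult) auto
  have "summable u"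
    by (rule summable_norm_cancel) (unfold norm_u, rule summable_norm_term)
  then have "dirichlet_sum lam a (Complex x y) - u (\<nu> x) = (\<Sum>i. u (i + Suc (\<nu> x))) + (\<Sum>n<\<nu> x. u n)"
    using suminf_split_initial_segment[of u "Suc (\<nu> x)"]
    by (simp add: dirichlet_sum_def u_def[symmetric])
  also have "norm \<dots> \<le> norm (\<Sum>i. u (i + Suc (\<nu> x))) + norm (\<Sum>n<\<nu> x. u n)"
    by (rule norm_triangle_ineq)
  also have "norm (\<Sum>i. u (i + Suc (\<nu> x))) \<le> C * 2"
    using norm_suminf_le[OF above sums_summable[OF geo]] sums_unique[OF geo] by simp
  also have "norm (\<Sum>n<\<nu> x. u n) \<le> C * 2"
  proof -
    have "norm (\<Sum>n<\<nu> x. u n) = norm (\<Sum>i<\<nu> x. u (\<nu> x - Suc i))"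
      by (simp only: sum.nat_diff_reindex)
    also have "\<dots> \<le> (\<Sum>i<\<nu> x. C * (1/2) ^ i)"
      using below by (intro sum_norm_le) auto
    also have "\<dots> \<le> C * 2"
      using sum_le_suminf[OF sums_summable[OF geo], of "{..<\<nu> x}"] sums_unique[OF geo] C by simp
    finally show ?thesis .
  qed
  finally show ?thesis by (simp add: u_def C_def algebra_simps)
qed

text \<open>
  Just before \<open>\<kappa> n\<close> the central index is at most \<open>n\<close>, so \<open>\<Phi> x \<le> lam n\<close> there. The argument needs points
  below \<open>\<kappa> n\<close> at which the growth hypothesis is available, that is, \<open>\<kappa> n > X\<close>; this is so for
  \<open>n \<ge> \<nu> (X + 1)\<close>.
\<close>

lemma \<kappa>_le_inverse:
  assumes \<Phi>: "\<Phi> \<in> class_L" and "0 \<le> X" and growth: "\<And>x. X \<le> x \<Longrightarrow> \<Phi> x \<le> lam (\<nu> x)"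
  shows "\<exists>K. \<forall>n\<ge>K. \<Phi> 0 \<le> lam n \<and> \<kappa> n \<le> the_inv_into {0..} \<Phi> (lam n)"
proof (intro exI allI impI)
  fix n assume n: "\<nu> (X + 1) \<le> n"
  have cont: "continuous_on {0..} \<Phi>" and sm: "strict_mono_on {0..} \<Phi>"
    and lim: "filterlim \<Phi> at_top at_top" using \<Phi> by (auto simp: class_L_def)
  have "\<Phi> 0 \<le> \<Phi> (X + 1)" using strict_mono_on_leD[OF sm, of 0 "X + 1"] assms(2) by simp
  also have "\<dots> \<le> lam (\<nu> (X + 1))" by (rule growth) simp
  also have "\<dots> \<le> lam n" using n lam_mono by (simp add: strict_mono_less_eq)
  finally have ge: "\<Phi> 0 \<le> lam n" .
  have "\<forall>\<^sub>F x in at_top. lam n \<le> \<Phi> x \<and> 0 \<le> x"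
    using lim by (intro eventually_conj eventually_ge_at_top) (auto simp: filterlim_at_top)
  then obtain b where "lam n \<le> \<Phi> b" "0 \<le> b"
    by (metis (mono_tags, lifting) eventually_at_top_linorder order_refl)
  then obtain t where t: "0 \<le> t" "\<Phi> t = lam n"
    using IVT'[of \<Phi> 0 "lam n" b] ge continuous_on_subset[OF cont, of "{0..b}"] by auto
  have inv: "the_inv_into {0..} \<Phi> (lam n) = t"
    using t strict_mono_on_imp_inj_on[OF sm] by (intro the_inv_into_f_eq) auto
  have "\<kappa> n \<le> t"
  proof (rule ccontr)
    assume "\<not> \<kappa> n \<le> t"
    moreover have "X + 1 \<le> \<kappa> n" using n by (rule \<kappa>_ge)
    ultimately obtain x where x: "max t X < x" "x < \<kappa> n"
      using dense[of "max t X" "\<kappa> n"] by auto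
    then have "\<nu> x \<le> n" using central_index_le_before_\<kappa> t by simp
    then have "lam (\<nu> x) \<le> \<Phi> t" unfolding t using lam_mono by (simp add: strict_mono_less_eq)
    moreover have "\<Phi> t < \<Phi> x" using strict_mono_onD[OF sm, of t x] x t by simp
    moreover have "\<Phi> x \<le> lam (\<nu> x)" using x by (intro growth) simp
    ultimately show False by simp
  qed
  with ge inv show "\<Phi> 0 \<le> lam n \<and> \<kappa> n \<le> the_inv_into {0..} \<Phi> (lam n)" by simp
qed

end

section \<open>The asymptotic relation\<close>

text \<open>
  The zero series has maximal term \<open>0\<close>, and \<open>ln 0 = 0\<close> by convention, which is smaller than \<open>x \<Phi> x\<close>.
\<close>

lemma class_D_Phi_nonzero:
  assumes \<Phi>: "\<Phi> \<in> class_L" and a: "a \<in> class_D_Phi lam \<Phi>"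
  shows "\<exists>n. a n \<noteq> 0"
proof (rule ccontr)
  assume "\<not> ?thesis"
  then have "max_term lam a x = 0" for x
    unfolding max_term_def by (intro Greatest_equality) auto
  moreover obtain x0 where "0 \<le> x0" "\<And>x. x0 < x \<Longrightarrow> x * \<Phi> x \<le> ln (max_term lam a x)"
    using a by (auto simp: class_D_Phi_def)
  ultimately have "(x0 + 1) * \<Phi> (x0 + 1) \<le> ln 0" by (metis less_add_one)
  then have "(x0 + 1) * \<Phi> (x0 + 1) \<le> 0" by simp
  moreover have "0 < \<Phi> (x0 + 1)" using \<Phi> \<open>0 \<le> x0\<close> by (simp add: class_L_def)
  ultimately show False using \<open>0 \<le> x0\<close> by (simp add: mult_le_0_iff)
qed

theorem theorem2p1:
  fixes lam :: "nat \<Rightarrow> real" and \<Phi> \<phi> h :: "real \<Rightarrow> real"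
  assumes "lam 0 = 0" and "strict_mono lam" and "filterlim lam at_top sequentially"
    and "\<Phi> \<in> class_L" and "h \<in> class_L_plus"
    and "\<phi> = the_inv_into {0..} \<Phi>"
    and "\<forall>b>0. (\<lambda>k. 1 / (lam (Suc k) - lam k) *
                    deriv0 h (\<phi> (lam k) + b / (lam (Suc k) - lam k)))
                summable_on {k. lam k \<ge> \<Phi> 0}"
  shows "\<forall>a \<in> class_D_Phi lam \<Phi>.
           \<exists>E. E \<subseteq> {0..} \<and> E \<in> sets borel \<and> emeasure (h_measure h) E < \<infinity> \<and>
             (\<exists>\<omega> :: real \<Rightarrow> real \<Rightarrow> complex.
                uniform_limit UNIV \<omega> (\<lambda>y. 0) (inf at_top (principal (- E))) \<and>
                (\<forall>\<^sub>F x in inf at_top (principal (- E)). \<forall>y.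
                   dirichlet_sum lam a (Complex x y) =
                     (1 + \<omega> x y) * (a (central_index lam a x) *
                       exp (Complex x y * of_real (lam (central_index lam a x))))))"
proof
  fix a assume a: "a \<in> class_D_Phi lam \<Phi>"
  note h = \<open>h \<in> class_L_plus\<close> and \<Phi> = \<open>\<Phi> \<in> class_L\<close>
  interpret nonzero_dirichlet lam a
    using assms(2) a class_D_Phi_nonzero[OF \<Phi> a] by unfold_locales (auto simp: class_D_Phi_def)
  obtain X where X: "0 \<le> X" "\<And>x. X \<le> x \<Longrightarrow> \<Phi> x \<le> lam (\<nu> x)"
    using central_exponent_ge[OF \<Phi> a] by blast
  have central_index_ev: "\<forall>\<^sub>F x in at_top. 0 \<le> x \<and> n < \<nu> x" for n
  proof -
    have "\<forall>\<^sub>F x in at_top. lam n < \<Phi> x"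
      using \<Phi> by (simp add: class_L_def filterlim_at_top_dense)
    then show ?thesis using eventually_ge_at_top[of X]
    proof eventually_elim
      case (elim x)
      then have "lam n < lam (\<nu> x)" using X(2)[of x] by simp
      then show ?case using lam_mono X(1) elim by (simp add: strict_mono_less)
    qed
  qed
  interpret unbounded_dirichlet lam a
  proof
    show "\<exists>x\<ge>0. n < \<nu> x" for n
      using eventually_happens[OF central_index_ev[of n]] by auto
  qed
  define \<Delta> where "\<Delta> k = lam (Suc k) - lam k" for k
  have \<Delta>: "0 < \<Delta> k" for k unfolding \<Delta>_def using lam_mono by (simp add: strict_mono_less)
  obtain K where K: "\<And>k. K \<le> k \<Longrightarrow> \<Phi> 0 \<le> lam k \<and> \<kappa> k \<le> \<phi> (lam k)"
    using \<kappa>_le_inverse[OF \<Phi> X] unfolding assms(6) by blast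
  \<comment> \<open>The radius has the numerator \<open>m + 1\<close>, so that already the sets with \<open>m = 0\<close> keep \<open>x\<close> away from
      every transition point by the distance that \<open>remainder_le\<close> asks of all gaps.\<close>
  define U where "U m k = {\<kappa> k - real (Suc m) / \<Delta> k<..<\<kappa> k + real (Suc m) / \<Delta> k}" for m k
  have "\<exists>N\<ge>K. emeasure (h_measure h) (\<Union>k\<in>{N..}. U m k) \<le> ennreal ((1/2) ^ m)" for m
    unfolding U_def
  proof (rule h_measure_interval_tail_le[OF h])
    have "(\<lambda>k. 1 / \<Delta> k * deriv0 h (\<phi> (lam k) + real (Suc m) / \<Delta> k)) summable_on {K..}"
      unfolding \<Delta>_def
      by (rule summable_on_subset_banach[OF assms(7)[rule_format]]) (use K in auto)
    from summable_on_cmult_right[OF this, of "real (Suc m)"]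
    show "(\<lambda>k. real (Suc m) / \<Delta> k * deriv0 h (\<phi> (lam k) + real (Suc m) / \<Delta> k)) summable_on {K..}"
      by (simp add: mult.assoc)
  qed (use K \<kappa>_nonneg \<Delta> in auto)
  then obtain N where N: "\<And>m. emeasure (h_measure h) (\<Union>k\<in>{N m..}. U m k) \<le> ennreal ((1/2) ^ m)"
    by metis
  \<comment> \<open>These are the finitely many indices left out by the tail with \<open>m = 0\<close>.\<close>
  define A where "A = (\<Union>k\<in>{..<N 0}. U 0 k)"
  define B where "B m = (\<Union>k\<in>{N m..}. U m k)" for m
  define E where "E = {0..} \<inter> (A \<union> (\<Union>m. B m))"
  have U_sets: "U m k \<in> sets borel" for m k by (simp add: U_def)
  have A_sets: "A \<in> sets borel" and B_sets: "\<And>m. B m \<in> sets borel"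
    using U_sets by (auto simp: A_def B_def)
  have "emeasure (h_measure h) E \<le> emeasure (h_measure h) (A \<union> (\<Union>m. B m))"
    using A_sets B_sets by (intro emeasure_mono) (auto simp: E_def h_measure_def)
  also have "\<dots> \<le> emeasure (h_measure h) A + emeasure (h_measure h) (\<Union>m. B m)"
    using A_sets B_sets by (intro emeasure_subadditive) (auto simp: h_measure_def)
  also have "\<dots> < \<infinity>"
  proof -
    have "emeasure (h_measure h) A \<le> (\<Sum>k<N 0. emeasure (h_measure h) (U 0 k))"
      unfolding A_def using U_sets by (intro emeasure_subadditive_finite) (auto simp: h_measure_def)
    also have "\<dots> < \<infinity>"
    proof -
      have "emeasure (h_measure h) (U 0 k) < \<infinity>" for k
        unfolding U_def
        by (rule le_less_trans[OF h_measure_interval_le[OF h \<kappa>_nonneg order_refl]]) (use \<Delta> in auto)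
      then show ?thesis by simp
    qed
    finally have "emeasure (h_measure h) A < \<infinity>" .
    moreover have "emeasure (h_measure h) (\<Union>m. B m) < \<infinity>"
    proof -
      have "emeasure (h_measure h) (\<Union>m. B m) \<le> (\<Sum>m. emeasure (h_measure h) (B m))"
        using B_sets by (intro emeasure_subadditive_countably) (auto simp: h_measure_def)
      also have "\<dots> \<le> (\<Sum>m. ennreal ((1/2) ^ m))"
        using N by (intro suminf_le) (auto simp: B_def)
      also have "\<dots> = ennreal (\<Sum>m. (1/2) ^ m)"
        by (intro suminf_ennreal2) auto
      finally show ?thesis by (rule le_less_trans) simp
    qed
    ultimately show ?thesis by simp
  qed
  finally have E_finite: "emeasure (h_measure h) E < \<infinity>" .
  have outside: "real (Suc m) \<le> \<bar>x - \<kappa> k\<bar> * (lam (Suc k) - lam k)" if "x \<notin> U m k" for x m k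
  proof -
    have "real (Suc m) / \<Delta> k \<le> \<bar>x - \<kappa> k\<bar>" using that by (auto simp: U_def)
    then show ?thesis using \<Delta>[of k] by (simp add: \<Delta>_def pos_divide_le_eq)
  qed
  define T where "T x y = a (\<nu> x) * exp (Complex x y * of_real (lam (\<nu> x)))" for x y
  have norm_T: "norm (T x y) = \<mu> x" for x y
    unfolding T_def norm_term by (rule norm_central)
  then have T0: "T x y \<noteq> 0" for x y using max_term_pos[of x] by (metis norm_zero less_irrefl)
  define \<omega> where "\<omega> x y = dirichlet_sum lam a (Complex x y) / T x y - 1" for x y
  have "uniform_limit UNIV \<omega> (\<lambda>y. 0) (inf at_top (principal (- E)))"
    unfolding uniform_limit_iff
  proof (intro allI impI)
    fix e :: real assume "0 < e"
    obtain m :: nat where m: "4 / e < real m" using reals_Archimedean2 by blast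
    have "4 / e < exp (real (Suc m))"
      using m exp_ge_add_one_self[of "real (Suc m)"] by simp
    then have "4 < e * exp (real (Suc m))"
      using \<open>0 < e\<close> by (simp add: pos_divide_less_eq mult.commute del: of_nat_Suc)
    then have small: "4 * exp (- real (Suc m)) < e"
      by (simp add: exp_minus inverse_eq_divide pos_divide_less_eq del: of_nat_Suc)
    have "\<forall>y\<in>UNIV. dist (\<omega> x y) 0 < e" if x: "0 \<le> x \<and> N m < \<nu> x" and "x \<in> - E" for x
    proof
      fix y :: real
      have notin: "x \<notin> A" "\<And>m. x \<notin> B m" using that by (auto simp: E_def)
      have "norm (dirichlet_sum lam a (Complex x y) - T x y) \<le> 4 * exp (- real (Suc m)) * \<mu> x"
        unfolding T_def
      proof (rule remainder_le[where N = "N m"])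
        show "1 \<le> \<bar>x - \<kappa> k\<bar> * (lam (Suc k) - lam k)" for k
          using outside[of x 0 k] notin(1) notin(2)[of 0] by (cases "k < N 0") (auto simp: A_def B_def)
        show "real (Suc m) \<le> \<bar>x - \<kappa> k\<bar> * (lam (Suc k) - lam k)" if "N m \<le> k" for k
          using notin(2)[of m] that by (intro outside) (auto simp: B_def)
      qed (use x in auto)
      moreover have "\<omega> x y = (dirichlet_sum lam a (Complex x y) - T x y) / T x y"
        using T0[of x y] by (simp add: \<omega>_def diff_divide_distrib)
      ultimately have "norm (\<omega> x y) \<le> 4 * exp (- real (Suc m))"
        using max_term_pos[of x] by (simp add: norm_divide norm_T pos_divide_le_eq)
      then show "dist (\<omega> x y) 0 < e" using small by simp
    qed
    then show "\<forall>\<^sub>F x in inf at_top (principal (- E)). \<forall>y\<in>UNIV. dist (\<omega> x y) 0 < e"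
      unfolding eventually_inf_principal
      by (intro eventually_mono[OF central_index_ev[of "N m"]]) blast
  qed
  moreover have "dirichlet_sum lam a (Complex x y) = (1 + \<omega> x y) * T x y" for x y
    using T0[of x y] by (simp add: \<omega>_def)
  ultimately have "uniform_limit UNIV \<omega> (\<lambda>y. 0) (inf at_top (principal (- E))) \<and>
      (\<forall>\<^sub>F x in inf at_top (principal (- E)). \<forall>y.
         dirichlet_sum lam a (Complex x y) = (1 + \<omega> x y) *
           (a (\<nu> x) * exp (Complex x y * of_real (lam (\<nu> x)))))"
    by (simp add: T_def)
  moreover have "E \<subseteq> {0..}" "E \<in> sets borel"
    using A_sets B_sets by (auto simp: E_def)
  ultimately show "\<exists>E. E \<subseteq> {0..} \<and> E \<in> sets borel \<and> emeasure (h_measure h) E < \<infinity> \<and>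
             (\<exists>\<omega> :: real \<Rightarrow> real \<Rightarrow> complex.
                uniform_limit UNIV \<omega> (\<lambda>y. 0) (inf at_top (principal (- E))) \<and>
                (\<forall>\<^sub>F x in inf at_top (principal (- E)). \<forall>y.
                   dirichlet_sum lam a (Complex x y) =
                     (1 + \<omega> x y) * (a (\<nu> x) * exp (Complex x y * of_real (lam (\<nu> x))))))"
    using E_finite by blast
qed

end
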